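(* Let $q>2$ be a prime power. Let $G$ be any graph on $s$ vertices $t_1,\dots,t_s$, and let $H=G\cup T_{i_1}\cup\cdots\cup T_{i_n}$ be the graph obtained from $G$ by attaching, for $j=1,\dots,n$, a tree $T_{i_j}$ with $s_j$ edges at the vertex $t_{i_j}$, where $T_{i_j}$ has vertex set $\{t_{i_j},z_{j,1},\dots,z_{j,s_j}\}$. For any $f\in KE(H)$, write $$f(t_1,\dots,t_s,z_{1,1},\dots,z_{n,s_n})=g(t_1,\dots,t_s)+g'(t_{i_1},\dots,t_{i_n},z_{1,1},\dots,z_{n,s_n}),$$ with $g\in KE(G)$ and $g'\in KE(T_{i_1}\cup\cdots\cup T_{i_n})$. Suppose that $g'$ has exactly $r$ non-zero terms. Then $$|V_{(\mathbb{F}_q^* )^m}(f)|=(-1)^r(q-1)^{p-r}\,|V_{(\mathbb{F}_q^* )^s}(g)|+\sum_{i=1}^{r}(-1)^{i+1}(q-1)^{m-i},$$ where $m=s+s_1+\cdots+s_n$ and $p=s_1+\cdots+s_n$.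
   Context: $K=\mathbb{F}_q$ is the finite field with $q$ elements and $\mathbb{F}_q^*=\mathbb{F}_q\setminus\{0\}$. Graphs are finite and simple; vertices are also regarded as variables. For a graph $G$ with edge set $E$, $KE(G)=\mathrm{span}_K\{uv : \{u,v\}\in E\}$ inside the polynomial ring over $K$ in the vertices of $G$. The number of non-zero terms of a polynomial in $KE(G)$ is the number of edge monomials having non-zero coefficient. For a polynomial $f$ in $N$ variables, $V_{(\mathbb{F}_q^* )^N}(f)=\{P\in(\mathbb{F}_q^* )^N : f(P)=0\}$. Attaching trees: $t_{i_1},\dots,t_{i_n}$ are distinct vertices of $G$; the vertices $z_{j,k}$ ($1\le j\le n$, $1\le k\le s_j$) are new and pairwise distinct; $T_{i_j}$ is a tree on $\{t_{i_j},z_{j,1},\dots,z_{j,s_j}\}$ (so it has $s_j$ edges and $s_j+1$ vertices). The graph $H$ has vertex set $\{t_1,\dots,t_s\}\cup\{z_{j,k}\}$, and its edges are exactly the edges of $G$ together with the edges of the trees $T_{i_1},\dots,T_{i_n}$. The polynomial $f$ is regarded as a polynomial in all $m$ vertices of $H$, and $g$ as a polynomial in the $s$ vertices of $G$. Empty sums are $0$. *)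

theory Defs
  imports "HOL-Library.Poly_Mapping" "HOL-Library.Cardinality" "HOL-Library.FuncSet"
    "HOL.Vector_Spaces"
begin

definition simple_graph :: "'v set \<Rightarrow> 'v set set \<Rightarrow> bool" where
  "simple_graph V E \<longleftrightarrow>
     finite V \<and> (\<forall>e\<in>E. \<exists>u v. u \<in> V \<and> v \<in> V \<and> u \<noteq> v \<and> e = {u, v})"

definition is_walk :: "'v set \<Rightarrow> 'v set set \<Rightarrow> 'v list \<Rightarrow> bool" where
  "is_walk V E xs \<longleftrightarrow>
     xs \<noteq> [] \<and> set xs \<subseteq> V \<and> (\<forall>i. Suc i < length xs \<longrightarrow> {xs ! i, xs ! Suc i} \<in> E)"

definition connected_graph :: "'v set \<Rightarrow> 'v set set \<Rightarrow> bool" where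
  "connected_graph V E \<longleftrightarrow>
     V \<noteq> {} \<and> (\<forall>u\<in>V. \<forall>v\<in>V. \<exists>xs. is_walk V E xs \<and> hd xs = u \<and> last xs = v)"

text \<open>A cycle is given by its vertices in cyclic order, the first one not repeated at the end.\<close>

definition is_cycle :: "'v set \<Rightarrow> 'v set set \<Rightarrow> 'v list \<Rightarrow> bool" where
  "is_cycle V E xs \<longleftrightarrow>
     is_walk V E xs \<and> length xs \<ge> 3 \<and> distinct xs \<and> {last xs, hd xs} \<in> E"

definition tree :: "'v set \<Rightarrow> 'v set set \<Rightarrow> bool" where
  "tree V E \<longleftrightarrow> simple_graph V E \<and> connected_graph V E \<and> (\<nexists>xs. is_cycle V E xs)"

text \<open>Polynomials in variables from \<open>'v\<close>: finitely supported coefficient functions on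
  monomials, where a monomial is a finitely supported exponent function. The library's
  product on \<^typ>\<open>('v \<Rightarrow>\<^sub>0 nat) \<Rightarrow>\<^sub>0 'k\<close> is then multiplication of polynomials.\<close>

type_synonym ('v, 'k) mpoly = "('v \<Rightarrow>\<^sub>0 nat) \<Rightarrow>\<^sub>0 'k"

definition var :: "'v \<Rightarrow> ('v, 'k::comm_ring_1) mpoly" where
  "var v = Poly_Mapping.single (Poly_Mapping.single v 1) 1"

definition scale_mpoly :: "'k \<Rightarrow> ('v, 'k) mpoly \<Rightarrow> ('v, 'k::comm_ring_1) mpoly" where
  "scale_mpoly c p = Poly_Mapping.single 0 c * p"

global_interpretation mpoly:
  vector_space "scale_mpoly :: 'k::field \<Rightarrow> ('v, 'k) mpoly \<Rightarrow> ('v, 'k) mpoly"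
  by unfold_locales
    (simp_all add: scale_mpoly_def algebra_simps single_add mult_single
      flip: mult.assoc)

definition eval_mpoly :: "('v \<Rightarrow> 'k) \<Rightarrow> ('v, 'k::comm_ring_1) mpoly \<Rightarrow> 'k" where
  "eval_mpoly P p =
     (\<Sum>M\<in>Poly_Mapping.keys p. Poly_Mapping.lookup p M *
       (\<Prod>v\<in>Poly_Mapping.keys M. P v ^ Poly_Mapping.lookup M v))"

definition KE :: "'v set set \<Rightarrow> ('v, 'k::field) mpoly set" where
  "KE E = mpoly.span {var u * var v | u v. {u, v} \<in> E}"

text \<open>\<^term>\<open>Poly_Mapping.single u 1 + Poly_Mapping.single v 1\<close> is the exponent of the
  edge monomial \<open>uv\<close>; each edge is counted once, since both orders of its ends give the
  same exponent.\<close>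

definition num_terms :: "'v set set \<Rightarrow> ('v, 'k::zero) mpoly \<Rightarrow> nat" where
  "num_terms E p =
     card {M. Poly_Mapping.lookup p M \<noteq> 0 \<and>
       (\<exists>u v. {u, v} \<in> E \<and> M = Poly_Mapping.single u 1 + Poly_Mapping.single v 1)}"

text \<open>The zeros of \<open>p\<close>, as a polynomial in the variables \<open>V\<close>, with all coordinates nonzero;
  points are functions on \<open>V\<close>, extended by \<^const>\<open>undefined\<close>. This is only meaningful if
  all variables of \<open>p\<close> belong to \<open>V\<close>.\<close>

definition torus_zeros :: "'v set \<Rightarrow> ('v, 'k::comm_ring_1) mpoly \<Rightarrow> ('v \<Rightarrow> 'k) set" where
  "torus_zeros V p = {P \<in> V \<rightarrow>\<^sub>E UNIV - {0}. eval_mpoly P p = 0}"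

text \<open>Every polynomial in \<open>KE(G \<union> T)\<close> splits into one in \<open>KE(G)\<close> and one in \<open>KE(T)\<close>.\<close>

lemma KE_Un:
  "(KE (E \<union> F) :: ('a, 'b::field) mpoly set) = {g + h | g h. g \<in> KE E \<and> h \<in> KE F}"
proof -
  have "({var u * var v | u v. {u, v} \<in> E \<union> F} :: ('a, 'b) mpoly set) =
      {var u * var v | u v. {u, v} \<in> E} \<union> {var u * var v | u v. {u, v} \<in> F}"
    by blast
  then show ?thesis
    by (simp only: KE_def mpoly.span_Un)
qed

end

theory Submission
  imports Defs
begin

text \<open>
  Attaching trees to a graph amounts to adding pendant edges one after another: each step brings
  one new vertex \<open>v\<close>, joined to one vertex \<open>u\<close> that is already present. The statement is
  therefore an induction on such a construction, once one understands a single step. Let \<open>k\<close> be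
  a polynomial in the old variables \<open>V\<close> and consider \<open>k + c u v\<close>. If \<open>c = 0\<close>, the value of \<open>v\<close>
  is free and the number of zeros is multiplied by \<open>q - 1\<close>. If \<open>c \<noteq> 0\<close>, then for every old
  point \<open>P\<close> the equation forces \<open>v = - k(P) / (c P(u))\<close>, and this value lies in the torus exactly
  when \<open>k(P) \<noteq> 0\<close>; hence the new zeros correspond to the old \<^emph>\<open>non-zeros\<close>, and their number is
  \<open>(q - 1) ^ card V\<close> minus the old number. Iterating these two rules gives the
  alternating sum; the steps with \<open>c \<noteq> 0\<close> are the non-zero terms of \<open>g'\<close>.

  The graph-theoretic part is that a tree can be built by pendant edges from any of its
  vertices (\<open>tree_pendant\<close>), so that all the trees together are built from the vertices of \<open>G\<close>
  (\<open>pendant_glue\<close>). The algebraic part is the rule for one step (\<open>card_torus_zeros_pendant_edge\<close>)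
  and its iteration (\<open>card_torus_zeros_pendant\<close>).
\<close>

section \<open>Growing a graph by pendant edges\<close>

text \<open>The set \<open>F\<close> contains only the added edges, none inside \<open>W\<close>: the graph on \<open>W\<close> to which the trees
  are attached is arbitrary.\<close>

inductive pendant :: "'v set \<Rightarrow> 'v set \<Rightarrow> 'v set set \<Rightarrow> bool" for W where
  base: "pendant W W {}"
| step: "pendant W V F \<Longrightarrow> u \<in> V \<Longrightarrow> v \<notin> V \<Longrightarrow> pendant W (insert v V) (insert {u, v} F)"

lemma pendant_subset: "pendant W V F \<Longrightarrow> W \<subseteq> V"
  by (induction rule: pendant.induct) auto

lemma pendant_Union_subset: "pendant W V F \<Longrightarrow> \<Union>F \<subseteq> V"
  by (induction rule: pendant.induct) auto

lemma pendant_finite: "pendant W V F \<Longrightarrow> finite W \<Longrightarrow> finite V"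
  by (induction rule: pendant.induct) auto

lemma pendant_glue:
  assumes "pendant U V F'" "pendant W A F" "U \<subseteq> A" "(V - U) \<inter> A = {}"
  shows "pendant W (A \<union> V) (F \<union> F')"
  using assms
proof (induction rule: pendant.induct)
  case base
  then show ?case by (simp add: sup_absorb1)
next
  case (step V F' u v)
  have "U \<subseteq> V" using step.hyps(1) by (rule pendant_subset)
  then have "v \<notin> A \<union> V" using step by blast
  moreover have "pendant W (A \<union> V) (F \<union> F')" using step by blast
  ultimately have "pendant W (insert v (A \<union> V)) (insert {u, v} (F \<union> F'))"
    using step.hyps(2) by (intro pendant.step) auto
  then show ?case by simp
qed

lemma is_walk_Cons:
  assumes "is_walk V F xs" "v \<in> V" "{v, hd xs} \<in> F"
  shows "is_walk V F (v # xs)"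
  using assms unfolding is_walk_def
  by (auto simp: nth_Cons hd_conv_nth split: nat.split)

lemma is_walk_snoc:
  assumes "is_walk V F xs" "v \<in> V" "{last xs, v} \<in> F"
  shows "is_walk V F (xs @ [v])"
  unfolding is_walk_def
proof (intro conjI allI impI)
  fix l assume "Suc l < length (xs @ [v])"
  then consider "Suc l < length xs" | "Suc l = length xs" by force
  then show "{(xs @ [v]) ! l, (xs @ [v]) ! Suc l} \<in> F"
  proof cases
    case 1
    then show ?thesis using assms(1) by (simp add: is_walk_def nth_append)
  next
    case 2
    then have "xs \<noteq> []" "l = length xs - 1" by auto
    then show ?thesis using assms(3) 2 by (simp add: nth_append last_conv_nth)
  qed
qed (use assms in \<open>auto simp: is_walk_def\<close>)

lemma is_walk_mono: "is_walk V F xs \<Longrightarrow> V \<subseteq> V' \<Longrightarrow> F \<subseteq> F' \<Longrightarrow> is_walk V' F' xs"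
  unfolding is_walk_def by blast

text \<open>A path inside the old vertices has not visited the newly added one, so prolonging it by the
  pendant edge keeps it a path.\<close>

lemma pendant_path:
  assumes "pendant {w} V F" "a \<in> V" "b \<in> V"
  shows "\<exists>xs. is_walk V F xs \<and> distinct xs \<and> hd xs = a \<and> last xs = b"
  using assms
proof (induction arbitrary: a b rule: pendant.induct)
  case base
  then have "is_walk {w} {} [w] \<and> distinct [w] \<and> hd [w] = a \<and> last [w] = b"
    by (simp add: is_walk_def)
  then show ?case by blast
next
  case (step V F u v)
  let ?V = "insert v V" and ?F = "insert {u, v} F"
  have old: "\<exists>xs. is_walk ?V ?F xs \<and> set xs \<subseteq> V \<and> distinct xs \<and> hd xs = c \<and> last xs = d"
    if cd: "c \<in> V" "d \<in> V" for c d
  proof -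
    obtain xs where xs: "is_walk V F xs" "distinct xs" "hd xs = c" "last xs = d"
      using step.IH[OF cd] by blast
    have "is_walk ?V ?F xs" using xs(1) by (rule is_walk_mono) auto
    then show ?thesis using xs unfolding is_walk_def by blast
  qed
  consider "a \<in> V" "b \<in> V" | "a = v" "b = v" | "a = v" "b \<in> V" | "a \<in> V" "b = v"
    using step.prems by blast
  then show ?case
  proof cases
    case 1
    then show ?thesis using old by blast
  next
    case 2
    then have "is_walk ?V ?F [v] \<and> distinct [v] \<and> hd [v] = a \<and> last [v] = b"
      by (simp add: is_walk_def)
    then show ?thesis by blast
  next
    case 3
    obtain xs where xs: "is_walk ?V ?F xs" "set xs \<subseteq> V" "distinct xs" "hd xs = u" "last xs = b"
      using old[OF step.hyps(2) 3(2)] by blast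
    have "is_walk ?V ?F (v # xs)"
      using xs(1,4) by (intro is_walk_Cons) (auto simp: insert_commute)
    moreover have "distinct (v # xs)" using xs step.hyps by auto
    moreover have "xs \<noteq> []" using xs(1) by (simp add: is_walk_def)
    ultimately show ?thesis using 3 xs by (intro exI[of _ "v # xs"]) simp
  next
    case 4
    obtain xs where xs: "is_walk ?V ?F xs" "set xs \<subseteq> V" "distinct xs" "hd xs = a" "last xs = u"
      using old[OF 4(1) step.hyps(2)] by blast
    have "is_walk ?V ?F (xs @ [v])"
      using xs(1,5) by (intro is_walk_snoc) auto
    moreover have "distinct (xs @ [v])" using xs step.hyps by auto
    moreover have "xs \<noteq> []" using xs(1) by (simp add: is_walk_def)
    ultimately show ?thesis using 4 xs by (intro exI[of _ "xs @ [v]"]) simp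
  qed
qed

lemma walk_crosses_edge:
  assumes "is_walk V F xs" "hd xs \<in> U" "last xs \<notin> U"
  shows "\<exists>u v. {u, v} \<in> F \<and> u \<in> U \<and> v \<notin> U \<and> v \<in> V"
proof (rule ccontr)
  assume none: "\<not> ?thesis"
  have ne: "xs \<noteq> []" using assms(1) by (simp add: is_walk_def)
  have "l < length xs \<Longrightarrow> xs ! l \<in> U" for l
  proof (induction l)
    case 0
    then show ?case using assms(2) by (simp add: hd_conv_nth)
  next
    case (Suc l)
    then have "xs ! l \<in> U" "{xs ! l, xs ! Suc l} \<in> F" "xs ! Suc l \<in> V"
      using assms(1) by (auto simp: is_walk_def dest: nth_mem)
    then show ?case using none by blast
  qed
  then have "last xs \<in> U" using ne by (simp add: last_conv_nth)
  then show False using assms(3) by simp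
qed

text \<open>Take a largest subgraph that can be grown from \<open>w\<close> by pendant edges. It contains all
  vertices, since otherwise connectedness yields one more pendant edge. It contains all edges,
  since an edge outside it would close a cycle with the path between its ends.\<close>

lemma tree_pendant:
  assumes tree: "tree V T" and w: "w \<in> V"
  shows "pendant {w} V T"
proof -
  have fin: "finite V"
    and edge: "\<And>e. e \<in> T \<Longrightarrow> \<exists>u v. u \<in> V \<and> v \<in> V \<and> u \<noteq> v \<and> e = {u, v}"
    and conn: "\<And>u v. u \<in> V \<Longrightarrow> v \<in> V \<Longrightarrow> \<exists>xs. is_walk V T xs \<and> hd xs = u \<and> last xs = v"
    and acyc: "\<And>xs. \<not> is_cycle V T xs"
    using tree unfolding tree_def simple_graph_def connected_graph_def by blast+
  define S where "S = {U. U \<subseteq> V \<and> (\<exists>F \<subseteq> T. pendant {w} U F)}"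
  have "finite S" using fin by (intro finite_subset[of S "Pow V"]) (auto simp: S_def)
  moreover have "{w} \<in> S" using w pendant.base[of "{w}"] unfolding S_def by blast
  ultimately obtain U where U: "U \<in> S" and max: "\<And>U'. U' \<in> S \<Longrightarrow> U \<subseteq> U' \<Longrightarrow> U = U'"
    using finite_has_maximal[of S] by blast
  obtain F where F: "F \<subseteq> T" "pendant {w} U F" and UV: "U \<subseteq> V"
    using U unfolding S_def by blast
  have "U = V"
  proof (rule ccontr)
    assume "U \<noteq> V"
    then obtain x where x: "x \<in> V" "x \<notin> U" using UV by blast
    have "w \<in> U" using pendant_subset[OF F(2)] by simp
    obtain xs where "is_walk V T xs" "hd xs = w" "last xs = x" using conn[OF w x(1)] by blast
    then obtain u v where uv: "{u, v} \<in> T" "u \<in> U" "v \<notin> U" "v \<in> V"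
      using walk_crosses_edge[of V T xs U] \<open>w \<in> U\<close> x(2) by blast
    have "pendant {w} (insert v U) (insert {u, v} F)"
      using F(2) uv by (intro pendant.step)
    then have "insert v U \<in> S" using uv F(1) UV unfolding S_def by blast
    then show False using max uv(3) by blast
  qed
  have "T \<subseteq> F"
  proof
    fix e assume e: "e \<in> T"
    show "e \<in> F"
    proof (rule ccontr)
      assume notin: "e \<notin> F"
      obtain a b where ab: "a \<in> V" "b \<in> V" "a \<noteq> b" "e = {a, b}" using edge[OF e] by blast
      obtain xs where xs: "is_walk V F xs" "distinct xs" "hd xs = a" "last xs = b"
        using pendant_path[OF F(2)] ab \<open>U = V\<close> by metis
      have "length xs \<noteq> 0" using xs(1) by (simp add: is_walk_def)
      moreover have "length xs \<noteq> 1" using xs(3,4) ab(3) by (auto simp: length_Suc_conv)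
      moreover have "length xs \<noteq> 2"
      proof
        assume "length xs = 2"
        then obtain c d where "xs = [c, d]" by (auto simp: numeral_2_eq_2 length_Suc_conv)
        then show False using xs ab(4) notin by (auto simp: is_walk_def)
      qed
      ultimately have "length xs \<ge> 3" by linarith
      moreover have "is_walk V T xs" using xs(1) F(1) by (blast intro: is_walk_mono)
      ultimately have "is_cycle V T xs"
        using xs e ab(4) unfolding is_cycle_def by (simp add: insert_commute)
      then show False using acyc by blast
    qed
  qed
  then show ?thesis using F \<open>U = V\<close> by (simp add: subset_antisym)
qed

section \<open>Evaluating edge polynomials\<close>

lemma eval_mpoly_superset:
  assumes "finite A" "Poly_Mapping.keys p \<subseteq> A"
  shows "eval_mpoly P p = (\<Sum>M\<in>A. Poly_Mapping.lookup p M *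
    (\<Prod>v\<in>Poly_Mapping.keys M. P v ^ Poly_Mapping.lookup M v))"
  unfolding eval_mpoly_def using assms
  by (intro sum.mono_neutral_left) (auto simp: in_keys_iff)

lemma eval_mpoly_add: "eval_mpoly P (p + p') = eval_mpoly P p + eval_mpoly P p'"
proof -
  let ?A = "Poly_Mapping.keys p \<union> Poly_Mapping.keys p'"
  have "Poly_Mapping.keys (p + p') \<subseteq> ?A" by (rule Poly_Mapping.keys_add)
  then show ?thesis
    by (simp add: eval_mpoly_superset[of ?A] lookup_add distrib_right sum.distrib)
qed

abbreviation edge_monom :: "'v \<Rightarrow> 'v \<Rightarrow> ('v \<Rightarrow>\<^sub>0 nat)" where
  "edge_monom u v \<equiv> Poly_Mapping.single u 1 + Poly_Mapping.single v 1"

lemma scale_mpoly_edge: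
  "scale_mpoly c (var u * var v) = Poly_Mapping.single (edge_monom u v) c"
  by (simp add: scale_mpoly_def var_def mult_single)

lemma keys_edge_monom: "Poly_Mapping.keys (edge_monom u v) = {u, v}"
  by (auto simp: in_keys_iff lookup_add lookup_single when_def split: if_splits)

lemma edge_monom_eq_iff: "edge_monom u v = edge_monom a b \<longleftrightarrow> {u, v} = {a, b}"
  using keys_edge_monom by (metis add.commute doubleton_eq_iff)

lemma eval_mpoly_edge: "eval_mpoly P (scale_mpoly c (var u * var v)) = c * (P u * P v)"
proof (cases "c = 0")
  case False
  show ?thesis
  proof (cases "u = v")
    case True
    then show ?thesis using \<open>c \<noteq> 0\<close> unfolding scale_mpoly_edge eval_mpoly_def
      by (simp add: keys_edge_monom lookup_add power2_eq_square del: One_nat_def)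
  next
    case False
    then have "Poly_Mapping.lookup (edge_monom u v) u = 1"
      "Poly_Mapping.lookup (edge_monom u v) v = 1"
      by (auto simp: lookup_add lookup_single when_def)
    then show ?thesis using \<open>c \<noteq> 0\<close> False
      unfolding scale_mpoly_edge eval_mpoly_def by (simp add: keys_edge_monom del: One_nat_def)
  qed
qed (simp add: scale_mpoly_edge eval_mpoly_def)

lemma KE_insert:
  fixes h :: "('v, 'k::field) mpoly"
  assumes "h \<in> KE (insert {u, v} F)"
  obtains c h0 where "h0 \<in> KE F" "h = h0 + scale_mpoly c (var u * var v)"
proof -
  have "({var x * var y | x y. {x, y} \<in> insert {u, v} F} :: ('v, 'k) mpoly set) =
      insert (var u * var v) {var x * var y | x y. {x, y} \<in> F}"
    by (auto simp: doubleton_eq_iff mult.commute)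
  then have "h \<in> mpoly.span (insert (var u * var v) {var x * var y | x y. {x, y} \<in> F})"
    using assms by (simp only: KE_def)
  then obtain c where "h - scale_mpoly c (var u * var v) \<in> KE F"
    by (auto simp: mpoly.span_insert KE_def)
  then show thesis using that[of "h - scale_mpoly c (var u * var v)" c] by simp
qed

lemma eval_mpoly_KE_cong:
  assumes "h \<in> KE E" and "\<And>x. x \<in> \<Union>E \<Longrightarrow> P x = P' x"
  shows "eval_mpoly P h = eval_mpoly P' h"
  using assms(1) unfolding KE_def
proof (induction rule: mpoly.span_induct_alt)
  case base
  then show ?case by (simp add: eval_mpoly_def)
next
  case (step c x y)
  then obtain u v where uv: "x = var u * var v" "{u, v} \<in> E" by blast
  then have "P u = P' u" "P v = P' v" using assms(2) by blast+
  then show ?case using step uv by (simp add: eval_mpoly_add eval_mpoly_edge)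
qed

lemma lookup_KE_eq_0:
  assumes "h \<in> KE F" and "{u, v} \<notin> F"
  shows "Poly_Mapping.lookup h (edge_monom u v) = 0"
  using assms(1) unfolding KE_def
proof (induction rule: mpoly.span_induct_alt)
  case (step c x y)
  then obtain a b where ab: "x = var a * var b" "{a, b} \<in> F" by blast
  then have "edge_monom a b \<noteq> edge_monom u v" using assms(2) edge_monom_eq_iff[of a b u v] by auto
  then show ?case using step ab by (simp add: scale_mpoly_edge lookup_add lookup_single)
qed simp

lemma num_terms_insert:
  assumes "h0 \<in> KE F" and "{u, v} \<notin> F"
  shows "num_terms (insert {u, v} F) (h0 + scale_mpoly c (var u * var v)) =
    num_terms F h0 + (if c = 0 then 0 else 1)"
proof -
  define S where "S F = {M. \<exists>a b. {a, b} \<in> F \<and> M = edge_monom a b}" for F :: "'a set set"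
  let ?h = "h0 + scale_mpoly c (var u * var v)"
  have terms: "num_terms F p = card {M \<in> S F. Poly_Mapping.lookup p M \<noteq> 0}"
    for F and p :: "('a, 'b) mpoly"
    unfolding num_terms_def S_def by (rule arg_cong[where f = card]) blast
  have S_insert: "S (insert {u, v} F) = insert (edge_monom u v) (S F)"
  proof (intro set_eqI iffI)
    fix M assume "M \<in> S (insert {u, v} F)"
    then obtain a b where ab: "{a, b} \<in> insert {u, v} F" "M = edge_monom a b"
      unfolding S_def by blast
    show "M \<in> insert (edge_monom u v) (S F)"
    proof (cases "{a, b} = {u, v}")
      case True
      then show ?thesis using ab(2) edge_monom_eq_iff[of a b u v] by blast
    next
      case False
      then show ?thesis using ab unfolding S_def by blast
    qed
  qed (unfold S_def, blast)
  have notin: "edge_monom u v \<notin> S F"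
  proof
    assume "edge_monom u v \<in> S F"
    then obtain a b where "{a, b} \<in> F" "edge_monom u v = edge_monom a b"
      unfolding S_def by blast
    then have "{a, b} \<in> F" "{u, v} = {a, b}" by (simp_all only: edge_monom_eq_iff)
    then show False using assms(2) by simp
  qed
  have lookup: "Poly_Mapping.lookup ?h M =
      Poly_Mapping.lookup h0 M + (if M = edge_monom u v then c else 0)" for M
    by (simp add: scale_mpoly_edge lookup_add lookup_single when_def eq_commute)
  have "{M \<in> S (insert {u, v} F). Poly_Mapping.lookup ?h M \<noteq> 0} =
      {M \<in> S F. Poly_Mapping.lookup h0 M \<noteq> 0} \<union> (if c = 0 then {} else {edge_monom u v})"
    using notin lookup_KE_eq_0[OF assms] unfolding S_insert lookup
    by (auto simp del: One_nat_def)
  moreover have "finite {M \<in> S F. Poly_Mapping.lookup h0 M \<noteq> 0}"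
    by (rule finite_subset[OF _ finite_keys[of h0]]) (auto simp: in_keys_iff)
  ultimately show ?thesis using notin unfolding terms by simp
qed

section \<open>Counting zeros in the torus\<close>

lemma card_torus:
  fixes V :: "'v set"
  assumes "finite V"
  shows "card (V \<rightarrow>\<^sub>E (UNIV - {0 :: 'k::{field, finite}})) = (CARD('k) - 1) ^ card V"
  using assms by (simp add: card_PiE card_Diff_singleton)

text \<open>The polynomial enters only through its independence of the new variable \<open>v\<close>. For \<open>c \<noteq> 0\<close>,
  forgetting the coordinate at \<open>v\<close> is a bijection from the new zeros onto the non-zeros of \<open>k\<close>;
  for \<open>c = 0\<close> it maps onto the zeros of \<open>k\<close>, and each fibre is a copy of the non-zero scalars.\<close>

lemma card_torus_zeros_pendant_edge:
  fixes k :: "('v, 'k::{field, finite}) mpoly" and c :: 'k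
  assumes fin: "finite V" and u: "u \<in> V" and v: "v \<notin> V"
    and indep: "\<And>P x. eval_mpoly (P(v := x)) k = eval_mpoly P k"
  shows "int (card (torus_zeros (insert v V) (k + scale_mpoly c (var u * var v)))) =
    (if c = 0 then (int CARD('k) - 1) * int (card (torus_zeros V k))
     else (int CARD('k) - 1) ^ card V - int (card (torus_zeros V k)))"
proof -
  let ?T = "UNIV - {0 :: 'k}"
  let ?Z = "torus_zeros (insert v V) (k + scale_mpoly c (var u * var v))"
  have uv: "u \<noteq> v" using u v by blast
  have one: "1 \<le> CARD('k)" by (simp add: Suc_leI)
  have ev: "eval_mpoly P (k + scale_mpoly c (var u * var v)) = eval_mpoly P k + c * (P u * P v)" for P
    by (simp add: eval_mpoly_add eval_mpoly_edge)
  have restr: "P(v := undefined) \<in> V \<rightarrow>\<^sub>E ?T" if "P \<in> insert v V \<rightarrow>\<^sub>E ?T" for P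
    using that v by (auto simp: PiE_iff extensional_def)
  have ext: "P(v := x) \<in> insert v V \<rightarrow>\<^sub>E ?T" if "P \<in> V \<rightarrow>\<^sub>E ?T" "x \<noteq> 0" for P x
    using that by (auto simp: PiE_iff extensional_def)
  have upd: "P(v := undefined) = P" if "P \<in> V \<rightarrow>\<^sub>E ?T" for P
    using that v by (auto simp: PiE_iff extensional_def)
  show ?thesis
  proof (cases "c = 0")
    case True
    have "bij_betw (\<lambda>P. (P v, P(v := undefined))) ?Z (?T \<times> torus_zeros V k)"
    proof (rule bij_betw_byWitness[where f' = "\<lambda>(x, P). P(v := x)"])
      show "\<forall>y\<in>?T \<times> torus_zeros V k.
          (\<lambda>P. (P v, P(v := undefined))) ((\<lambda>(x, P). P(v := x)) y) = y"
        using upd by (auto simp: torus_zeros_def)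
      show "(\<lambda>P. (P v, P(v := undefined))) ` ?Z \<subseteq> ?T \<times> torus_zeros V k"
        using restr True by (auto simp: torus_zeros_def ev indep)
      show "(\<lambda>(x, P). P(v := x)) ` (?T \<times> torus_zeros V k) \<subseteq> ?Z"
        using ext True by (auto simp: torus_zeros_def ev indep)
    qed auto
    then have "card ?Z = card (?T \<times> torus_zeros V k)" by (rule bij_betw_same_card)
    also have "\<dots> = (CARD('k) - 1) * card (torus_zeros V k)"
      by (simp add: card_cartesian_product card_Diff_singleton)
    finally show ?thesis using True one by (simp add: of_nat_diff)
  next
    case False
    let ?N = "{P \<in> V \<rightarrow>\<^sub>E ?T. eval_mpoly P k \<noteq> 0}"
    let ?x = "\<lambda>P. - eval_mpoly P k / (c * P u)"
    have "bij_betw (\<lambda>P. P(v := undefined)) ?Z ?N"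
    proof (rule bij_betw_byWitness[where f' = "\<lambda>P. P(v := ?x P)"])
      show "\<forall>P\<in>?Z. (\<lambda>P. P(v := ?x P)) (P(v := undefined)) = P"
      proof
        fix P assume P: "P \<in> ?Z"
        then have "P u \<noteq> 0" "eval_mpoly P k + c * (P u * P v) = 0"
          using u by (auto simp: torus_zeros_def ev PiE_iff)
        then have "P u \<noteq> 0" "- eval_mpoly P k = P v * (c * P u)"
          by (simp_all add: neg_eq_iff_add_eq_0 mult_ac)
        then have "?x P = P v" using False by simp
        then show "(\<lambda>P. P(v := ?x P)) (P(v := undefined)) = P" using uv by (simp add: indep)
      qed
      show "\<forall>P\<in>?N. (\<lambda>P. P(v := undefined)) (P(v := ?x P)) = P"
        using upd by auto
      show "(\<lambda>P. P(v := undefined)) ` ?Z \<subseteq> ?N"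
        using restr False u by (auto simp: torus_zeros_def ev indep PiE_iff)
      show "(\<lambda>P. P(v := ?x P)) ` ?N \<subseteq> ?Z"
      proof safe
        fix P assume P: "P \<in> V \<rightarrow>\<^sub>E ?T" "eval_mpoly P k \<noteq> 0"
        then have "P u \<noteq> 0" using u by (auto simp: PiE_iff)
        then show "P(v := ?x P) \<in> ?Z"
          using P ext[of P "?x P"] False uv by (simp add: torus_zeros_def ev indep)
      qed
    qed
    then have "card ?Z = card ?N" by (rule bij_betw_same_card)
    also have "?N = (V \<rightarrow>\<^sub>E ?T) - torus_zeros V k" by (auto simp: torus_zeros_def)
    finally have "card ?Z = card ((V \<rightarrow>\<^sub>E ?T) - torus_zeros V k)" .
    moreover have "torus_zeros V k \<subseteq> V \<rightarrow>\<^sub>E ?T" by (auto simp: torus_zeros_def)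
    moreover have "finite (V \<rightarrow>\<^sub>E ?T)" using fin by (simp add: finite_PiE)
    ultimately have "int (card ?Z) = int (card (V \<rightarrow>\<^sub>E ?T)) - int (card (torus_zeros V k))"
      by (simp add: card_Diff_subset finite_subset card_mono of_nat_diff)
    then show ?thesis using False one by (simp add: card_torus[OF fin] of_nat_diff)
  qed
qed

text \<open>The bound on the number of terms holds because each new vertex brings a single edge. It is
  carried through the induction to keep the truncated differences in the exponents exact.\<close>

lemma card_torus_zeros_pendant:
  fixes g h :: "('v, 'k::{field, finite}) mpoly"
  assumes "pendant W V F" and finW: "finite W" and g: "g \<in> KE E"
    and EW: "\<Union>E \<subseteq> W" and "h \<in> KE F"
  defines "Q \<equiv> int CARD('k) - 1"
  shows "num_terms F h + card W \<le> card V \<and>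
    int (card (torus_zeros V (g + h))) =
      (-1) ^ num_terms F h * Q ^ (card V - card W - num_terms F h) * int (card (torus_zeros W g))
      + (\<Sum>l=1..num_terms F h. (-1) ^ (l + 1) * Q ^ (card V - l))"
  using assms(1,5)
proof (induction arbitrary: h rule: pendant.induct)
  case base
  then have "h = 0" by (simp add: KE_def)
  then show ?case by (simp add: num_terms_def)
next
  case (step V F u v)
  let ?e = "var u * var v :: ('v, 'k) mpoly"
  obtain c h0 where h0: "h0 \<in> KE F" and h: "h = h0 + scale_mpoly c ?e"
    using KE_insert[OF step.prems] by blast
  define r where "r = num_terms F h0"
  define Z where "Z = int (card (torus_zeros W g))"
  have IH: "r + card W \<le> card V"
    "int (card (torus_zeros V (g + h0))) = (-1) ^ r * Q ^ (card V - card W - r) * Z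
      + (\<Sum>l=1..r. (-1) ^ (l + 1) * Q ^ (card V - l))"
    using step.IH[OF h0] unfolding r_def Z_def by blast+
  have WV: "W \<subseteq> V" and FV: "\<Union>F \<subseteq> V" and fin: "finite V"
    using step.hyps(1) finW by (auto dest: pendant_subset pendant_Union_subset pendant_finite)
  have indep: "eval_mpoly (P(v := x)) (g + h0) = eval_mpoly P (g + h0)" for P x
  proof -
    have "eval_mpoly (P(v := x)) g = eval_mpoly P g"
      using step.hyps(3) WV EW by (intro eval_mpoly_KE_cong[OF g]) auto
    moreover have "eval_mpoly (P(v := x)) h0 = eval_mpoly P h0"
      using step.hyps(3) FV by (intro eval_mpoly_KE_cong[OF h0]) auto
    ultimately show ?thesis by (simp add: eval_mpoly_add)
  qed
  have rec: "int (card (torus_zeros (insert v V) (g + h))) =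
    (if c = 0 then Q * int (card (torus_zeros V (g + h0)))
     else Q ^ card V - int (card (torus_zeros V (g + h0))))"
    using card_torus_zeros_pendant_edge[OF fin step.hyps(2,3) indep, of c]
    unfolding h Q_def by (simp add: add.assoc)
  have card: "card (insert v V) = Suc (card V)" using fin step.hyps(3) by simp
  have "{u, v} \<notin> F" using FV step.hyps(3) by blast
  then have num: "num_terms (insert {u, v} F) h = r + (if c = 0 then 0 else 1)"
    unfolding h r_def using h0 by (intro num_terms_insert)
  show ?case
  proof (cases "c = 0")
    case True
    have "Q * (\<Sum>l=1..r. (-1) ^ (l + 1) * Q ^ (card V - l)) =
        (\<Sum>l=1..r. (-1) ^ (l + 1) * Q ^ (Suc (card V) - l))"
      unfolding sum_distrib_left using IH(1)
      by (intro sum.cong) (auto simp: Suc_diff_le algebra_simps)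
    moreover have "Suc (card V) - card W - r = Suc (card V - card W - r)" using IH(1) by simp
    ultimately show ?thesis
      unfolding rec num card IH(2) Z_def[symmetric] using True IH(1) by (simp add: algebra_simps)
  next
    case False
    \<comment> \<open>The complement contributes the new leading term; the old sum is shifted by one and
      changes sign.\<close>
    have "(\<Sum>l=1..Suc r. (-1) ^ (l + 1) * Q ^ (Suc (card V) - l)) =
        Q ^ card V + (\<Sum>l=Suc 1..Suc r. (-1) ^ (l + 1) * Q ^ (Suc (card V) - l))"
      by (subst sum.atLeast_Suc_atMost) auto
    also have "(\<Sum>l=Suc 1..Suc r. (-1) ^ (l + 1) * Q ^ (Suc (card V) - l)) =
        - (\<Sum>l=1..r. (-1) ^ (l + 1) * Q ^ (card V - l))"
      by (subst sum.shift_bounds_cl_Suc_ivl) (simp add: sum_negf)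
    finally show ?thesis
      unfolding rec num card IH(2) Z_def[symmetric] using False IH(1) by simp
  qed
qed

theorem theorem3p5:
  fixes t :: "nat \<Rightarrow> 'v" and s :: nat and E :: "'v set set"
    and n :: nat and i :: "nat \<Rightarrow> nat" and ss :: "nat \<Rightarrow> nat" and z :: "nat \<Rightarrow> nat \<Rightarrow> 'v"
    and T :: "nat \<Rightarrow> 'v set set"
    and f g g' :: "('v, 'k::{field, finite}) mpoly"
    and q r m p :: nat
    and VG VH :: "'v set" and ET EH :: "'v set set"
  assumes q: "CARD('k) = q" "q > 2"
    and t: "inj_on t {1..s}"
    and VG: "VG = t ` {1..s}"
    and G: "simple_graph VG E"
    and i: "i \<in> {1..n} \<rightarrow> {1..s}" "inj_on i {1..n}"
    and z_distinct: "inj_on (\<lambda>(j, k). z j k) (SIGMA j:{1..n}. {1..ss j})"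
    and z_new: "\<And>j k. j \<in> {1..n} \<Longrightarrow> k \<in> {1..ss j} \<Longrightarrow> z j k \<notin> VG"
    and T: "\<And>j. j \<in> {1..n} \<Longrightarrow> tree (insert (t (i j)) (z j ` {1..ss j})) (T j)"
    and ET: "ET = (\<Union>j\<in>{1..n}. T j)"
    and EH: "EH = E \<union> ET"
    and VH: "VH = VG \<union> (\<Union>j\<in>{1..n}. z j ` {1..ss j})"
    and f: "f \<in> KE EH"
    and g: "g \<in> KE E"
    and g': "g' \<in> KE ET"
    and f_eq: "f = g + g'"
    and r: "num_terms ET g' = r"
    and m: "m = s + (\<Sum>j=1..n. ss j)"
    and p: "p = (\<Sum>j=1..n. ss j)"
  shows "int (card (torus_zeros VH f)) =
           (-1) ^ r * (int q - 1) ^ (p - r) * int (card (torus_zeros VG g))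
           + (\<Sum>l=1..r. (-1) ^ (l + 1) * (int q - 1) ^ (m - l))"
proof -
  let ?Z = "\<lambda>j. z j ` {1..ss j}"
  have grow: "pendant VG (VG \<union> (\<Union>j\<in>{1..k}. ?Z j)) (\<Union>j\<in>{1..k}. T j)" if "k \<le> n" for k
    using that
  proof (induction k)
    case 0
    then show ?case by (simp add: pendant.base)
  next
    case (Suc k)
    let ?A = "VG \<union> (\<Union>j\<in>{1..k}. ?Z j)" and ?w = "t (i (Suc k))"
    have k: "Suc k \<in> {1..n}" using Suc.prems by simp
    have w: "?w \<in> VG" using i(1) k VG by blast
    have "pendant {?w} (insert ?w (?Z (Suc k))) (T (Suc k))"
      using T[OF k] by (intro tree_pendant) auto
    moreover have "?Z (Suc k) \<inter> ?A = {}"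
    proof -
      have "z (Suc k) a \<noteq> z j b" if "a \<in> {1..ss (Suc k)}" "j \<in> {1..k}" "b \<in> {1..ss j}" for a j b
        using inj_onD[OF z_distinct, of "(Suc k, a)" "(j, b)"] that k by auto
      then show ?thesis using z_new[OF k] by blast
    qed
    ultimately have "pendant VG (?A \<union> insert ?w (?Z (Suc k))) ((\<Union>j\<in>{1..k}. T j) \<union> T (Suc k))"
      using Suc w by (intro pendant_glue) auto
    moreover have "?A \<union> insert ?w (?Z (Suc k)) = VG \<union> (\<Union>j\<in>{1..Suc k}. ?Z j)"
      using w by (auto simp: atLeastAtMostSuc_conv)
    moreover have "(\<Union>j\<in>{1..k}. T j) \<union> T (Suc k) = (\<Union>j\<in>{1..Suc k}. T j)"
      by (auto simp: atLeastAtMostSuc_conv)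
    ultimately show ?case by simp
  qed
  have pend: "pendant VG VH ET" using grow[of n] unfolding VH ET by simp
  have cVG: "card VG = s" unfolding VG using t by (simp add: card_image)
  have E_VG: "\<Union>E \<subseteq> VG" using G unfolding simple_graph_def by fastforce
  have fin: "finite VG" unfolding VG by simp
  have "card (\<Union>j\<in>{1..n}. ?Z j) = p"
  proof -
    have "(\<Union>j\<in>{1..n}. ?Z j) = (\<lambda>(j, k). z j k) ` (SIGMA j:{1..n}. {1..ss j})" by auto
    then show ?thesis using card_image[OF z_distinct] by (simp add: p)
  qed
  moreover have "VG \<inter> (\<Union>j\<in>{1..n}. ?Z j) = {}" using z_new by blast
  ultimately have cVH: "card VH = m"
    unfolding VH m using fin cVG p by (simp add: card_Un_disjoint)
  have "m - s = p" unfolding m p by simp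
  then show ?thesis
    using card_torus_zeros_pendant[OF pend fin g E_VG g'] unfolding f_eq r q(1) cVG cVH by simp
qed

end
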